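(* Let $A$ and $B$ be nonempty closed and convex subsets of a uniformly convex Banach space $X$. Let $T:(A\times B)\cup(B\times A)\to A\cup B$ be a $p$-cyclic $\phi$-contraction mapping. For $(x_0,y_0)\in A\times B$, define $x_n=T(x_{n-1},y_{n-1})$ and $y_n=T(y_{n-1},x_{n-1})$ for each $n\in\mathbb{N}$. Then $T$ has a unique coupled best proximity point.
   Context: For nonempty subsets $A,B$ of a normed space $X$, $dist(A,B)=\inf\{\|a-b\|: a\in A,\ b\in B\}$. The space $X\times X$ carries the norm $\|(x,y)\|=\max\{\|x\|,\|y\|\}$. A mapping $T:(A\times B)\cup(B\times A)\to A\cup B$ is a $p$-cyclic $\phi$-contraction mapping, where $\phi:[0,\infty)\to[0,\infty)$ is a strictly increasing map, if: (i) $T(A\times B)\subseteq B$ and $T(B\times A)\subseteq A$; (ii) $\|T(x,y)-T(u,v)\|\le \|(x,y)-(u,v)\|-\phi(\|(x,y)-(u,v)\|)+\phi(dist(A,B))$ for all $(x,y)\in A\times B$ and $(u,v)\in B\times A$. A point $(a,b)\in A\times B$ is a coupled best proximity point of $T$ if $\|a-T(a,b)\|=dist(A,B)$ and $\|b-T(b,a)\|=dist(A,B)$. A Banach space $X$ is uniformly convex if there is a strictly increasing function $\delta:(0,2]\to[0,1]$ such that for all $x,y,z\in X$, $R>0$ and $r\in(0,2R]$ with $\|x-z\|\le R$, $\|y-z\|\le R$ and $\|x-y\|\ge r$ one has $\left\|\frac{x+y}{2}-z\right\|\le\left(1-\delta\left(\frac{r}{R}\right)\right)R$. $\mathbb{N}=\{1,2,\dots\}$.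 *)

theory Defs
  imports "HOL-Analysis.Analysis"
begin

text \<open>The library norm on \<open>'a \<times> 'a\<close> is the Euclidean combination of the
  component norms, so the maximum norm is introduced separately.\<close>

definition max_norm :: "'a::real_normed_vector \<times> 'a \<Rightarrow> real" where
  "max_norm p = max (norm (fst p)) (norm (snd p))"

definition uniformly_convex_space :: "'a::real_normed_vector itself \<Rightarrow> bool" where
  "uniformly_convex_space _ \<longleftrightarrow>
     (\<exists>\<delta> :: real \<Rightarrow> real.
        strict_mono_on {0<..2} \<delta> \<and> \<delta> ` {0<..2} \<subseteq> {0..1} \<and>
        (\<forall>(x::'a) y z R r.
           0 < R \<longrightarrow> r \<in> {0<..2 * R} \<longrightarrow>
           norm (x - z) \<le> R \<longrightarrow> norm (y - z) \<le> R \<longrightarrow> r \<le> norm (x - y) \<longrightarrow>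
           norm ((1 / 2) *\<^sub>R (x + y) - z) \<le> (1 - \<delta> (r / R)) * R))"

text \<open>The maps \<open>\<phi>\<close> and \<open>T\<close> are total functions in HOL; only their values on
  \<open>{0..}\<close> and on \<open>A \<times> B \<union> B \<times> A\<close>, respectively, are constrained.\<close>

definition p_cyclic_contraction ::
  "'a::real_normed_vector set \<Rightarrow> 'a set \<Rightarrow> (real \<Rightarrow> real) \<Rightarrow> ('a \<times> 'a \<Rightarrow> 'a) \<Rightarrow> bool" where
  "p_cyclic_contraction A B \<phi> T \<longleftrightarrow>
     \<phi> ` {0..} \<subseteq> {0..} \<and> strict_mono_on {0..} \<phi> \<and>
     T ` (A \<times> B) \<subseteq> B \<and> T ` (B \<times> A) \<subseteq> A \<and>
     (\<forall>p \<in> A \<times> B. \<forall>q \<in> B \<times> A.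
        norm (T p - T q) \<le> max_norm (p - q) - \<phi> (max_norm (p - q)) + \<phi> (setdist A B))"

definition coupled_best_proximity_point ::
  "'a::real_normed_vector set \<Rightarrow> 'a set \<Rightarrow> ('a \<times> 'a \<Rightarrow> 'a) \<Rightarrow> 'a \<times> 'a \<Rightarrow> bool" where
  "coupled_best_proximity_point A B T p \<longleftrightarrow>
     (case p of (a, b) \<Rightarrow>
        a \<in> A \<and> b \<in> B \<and>
        norm (a - T (a, b)) = setdist A B \<and> norm (b - T (b, a)) = setdist A B)"

end

theory Submission
  imports Defs
begin

text \<open>
  The two coupled equations become one by doubling: put \<open>F (u, v) = (T (u, v), T (v, u))\<close>.
  Then \<open>F\<close> exchanges \<open>P = A \<times> B\<close> and \<open>Q = B \<times> A\<close>, it is a cyclic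
  \<open>\<phi>\<close>-contraction for the maximum metric, the distance between \<open>P\<close> and \<open>Q\<close> is again
  \<open>D = dist(A, B)\<close>, and a coupled best proximity point of \<open>T\<close> is a point \<open>p \<in> P\<close> with
  \<open>d p (F p) = D\<close>.

  The maximum norm on the product is not uniformly convex (unless the space is trivial), but
  all that is wanted from convexity is the following property of the pair \<open>(P, Q)\<close>: two
  points of \<open>P\<close> that are almost at distance \<open>D\<close> from the same point of \<open>Q\<close> are close to
  each other.  For \<open>(A, B)\<close> this holds because the midpoint of the two points
  lies in \<open>A\<close> and uniform convexity would otherwise bring it closer than \<open>D\<close> to \<open>B\<close>
  (\<open>uniformly_convex_proximity\<close>); the property is inherited by \<open>(P, Q)\<close>
  componentwise.

  Given this property, the theorem is metric.  Put \<open>G = F \<circ> F\<close>, which maps \<open>P\<close> to itself.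
  Along an orbit of \<open>G\<close> the distance \<open>d p (F p)\<close> drops by at least
  \<open>\<phi> (d p (F p)) - \<phi> D\<close> in each step, so it tends to \<open>D\<close>
  (\<open>decrease_by_excess_eventually_small\<close>); hence consecutive points of the orbit get close.
  As \<open>\<phi>\<close> strictly increases, a step of \<open>G\<close> shortens any distance between \<open>P\<close> and \<open>Q\<close>
  that is bounded away from \<open>D\<close> by a fixed amount, which is enough to absorb the small gap
  between neighbours: for large \<open>n\<close> the \<open>n\<close>-th point of the orbit is almost at distance \<open>D\<close>
  from the images under \<open>F\<close> of all later points (\<open>orbit_uniform_proximity\<close>).  So the orbit is Cauchy (\<open>Cauchy_orbit\<close>), and its limit is a best proximity point.
  For uniqueness, best proximity points are fixed points of \<open>G\<close>, and the strict decrease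
  forces \<open>d p (F p') = D\<close> for any two of them, so that \<open>p = p'\<close>.
\<close>

section \<open>Sequences that decrease by their excess\<close>

text \<open>If \<open>s\<close> stayed above \<open>D + e\<close>, it would drop by at least \<open>\<phi> (D + e) - \<phi> D > 0\<close> in
  every step, contradicting the lower bound.\<close>

lemma decrease_by_excess_eventually_small:
  fixes s :: "nat \<Rightarrow> real"
  assumes mono: "strict_mono_on {D..} \<phi>"
    and lower: "\<And>n. D \<le> s n"
    and step: "\<And>n. s (Suc n) \<le> s n - \<phi> (s n) + \<phi> D"
    and "0 < e"
  shows "\<exists>N. \<forall>n\<ge>N. s n < D + e"
proof -
  have "\<phi> D \<le> \<phi> (s n)" for n
    using strict_mono_on_leD[OF mono, of D "s n"] lower[of n] by simp
  then have "s (Suc n) \<le> s n" for n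
    using step[of n] by (smt (verit))
  then have "decseq s"
    by (rule decseq_SucI)
  have "\<exists>n. s n < D + e"
  proof (rule ccontr)
    assume "\<nexists>n. s n < D + e"
    then have ge: "D + e \<le> s n" for n
      by (simp add: not_less)
    define c where "c = \<phi> (D + e) - \<phi> D"
    have "c > 0"
      using strict_mono_onD[OF mono, of D "D + e"] \<open>0 < e\<close> by (simp add: c_def)
    have "\<phi> (D + e) \<le> \<phi> (s n)" for n
      using strict_mono_on_leD[OF mono, of "D + e" "s n"] ge[of n] \<open>0 < e\<close> by simp
    then have drop: "s (Suc n) \<le> s n - c" for n
      using step[of n] by (smt (verit) c_def)
    have lin: "s n \<le> s 0 - real n * c" for n
    proof (induction n)
      case (Suc n)
      then show ?case
        using drop[of n] by (simp add: algebra_simps)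
    qed simp
    obtain n :: nat where "s 0 - D < real n * c"
      using reals_Archimedean3[OF \<open>c > 0\<close>] by blast
    then show False
      using lin[of n] lower[of n] by linarith
  qed
  then obtain N where "s N < D + e" ..
  then have "\<forall>n\<ge>N. s n < D + e"
    using decseqD[OF \<open>decseq s\<close>] le_less_trans by blast
  then show ?thesis ..
qed

section \<open>Best proximity points of cyclic contractions\<close>

text \<open>The assumption \<open>proximity\<close> is a quantified form of the property UC of Suzuki, Kikkawa
  and Vetro; it is what uniform convexity contributes.  The number \<open>D\<close> stands for the distance between
  \<open>P\<close> and \<open>Q\<close>.\<close>

locale proximal_cyclic_contraction = Metric_space M d
  for M :: "'b set" and d :: "'b \<Rightarrow> 'b \<Rightarrow> real" +
  fixes P Q :: "'b set" and F :: "'b \<Rightarrow> 'b" and \<phi> :: "real \<Rightarrow> real" and D :: real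
  assumes P_sub: "P \<subseteq> M" and Q_sub: "Q \<subseteq> M"
    and F_P: "p \<in> P \<Longrightarrow> F p \<in> Q" and F_Q: "q \<in> Q \<Longrightarrow> F q \<in> P"
    and D_le: "p \<in> P \<Longrightarrow> q \<in> Q \<Longrightarrow> D \<le> d p q"
    and mono: "strict_mono_on {D..} \<phi>"
    and contraction: "p \<in> P \<Longrightarrow> q \<in> Q \<Longrightarrow> d (F p) (F q) \<le> d p q - \<phi> (d p q) + \<phi> D"
    and proximity: "0 < e \<Longrightarrow> \<exists>\<eta>>0. \<forall>p\<in>P. \<forall>p'\<in>P. \<forall>q\<in>Q.
          d p q < D + \<eta> \<longrightarrow> d p' q < D + \<eta> \<longrightarrow> d p p' < e"
begin

lemma nonexpansive:
  assumes "p \<in> P" "q \<in> Q"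
  shows "d (F p) (F q) \<le> d p q"
  using strict_mono_on_leD[OF mono, of D "d p q"] D_le[OF assms] contraction[OF assms] by simp

lemma twice_contraction:
  assumes "p \<in> P" "q \<in> Q"
  shows "d (F (F p)) (F (F q)) \<le> d p q - \<phi> (d p q) + \<phi> D"
proof -
  have "d (F (F p)) (F (F q)) = d (F (F q)) (F (F p))"
    by (rule commute)
  also have "\<dots> \<le> d (F q) (F p)"
    using assms by (intro nonexpansive F_P F_Q)
  also have "\<dots> = d (F p) (F q)"
    by (rule commute)
  also have "\<dots> \<le> d p q - \<phi> (d p q) + \<phi> D"
    using assms by (rule contraction)
  finally show ?thesis .
qed

lemma same_nearest_imp_eq:
  assumes "p \<in> P" "p' \<in> P" "q \<in> Q" "d p q \<le> D" "d p' q \<le> D"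
  shows "p = p'"
proof (rule ccontr)
  assume "p \<noteq> p'"
  then have "0 < d p p'"
    using assms P_sub by (simp add: subset_iff)
  then obtain \<eta> where "\<eta> > 0"
    and "\<forall>p1\<in>P. \<forall>p2\<in>P. \<forall>q\<in>Q. d p1 q < D + \<eta> \<longrightarrow> d p2 q < D + \<eta> \<longrightarrow> d p1 p2 < d p p'"
    using proximity by blast
  moreover have "d p q < D + \<eta>" "d p' q < D + \<eta>"
    using assms \<open>\<eta> > 0\<close> by auto
  ultimately show False
    using assms by fastforce
qed

lemma best_proximity_fixes_twice:
  assumes "p \<in> P" "d p (F p) = D"
  shows "F (F p) = p"
proof (rule same_nearest_imp_eq)
  show "d (F (F p)) (F p) \<le> D"
    using nonexpansive[of p "F p"] assms F_P by (simp add: commute)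
qed (use assms F_P F_Q in auto)

text \<open>Both \<open>p\<close> and \<open>p'\<close> are fixed by \<open>F \<circ> F\<close>, so \<open>d p (F p')\<close> is bounded by the value that
  the contraction assigns to it; this is possible only at \<open>D\<close>.  Then \<open>F p'\<close> is nearest to both
  points.\<close>

lemma best_proximity_unique:
  assumes "p \<in> P" "p' \<in> P" "d p (F p) = D" "d p' (F p') = D"
  shows "p = p'"
proof -
  let ?t = "d p (F p')"
  have "F p' \<in> Q"
    using assms F_P by blast
  have "?t \<le> ?t - \<phi> ?t + \<phi> D"
    using twice_contraction[OF \<open>p \<in> P\<close> \<open>F p' \<in> Q\<close>] assms
    by (simp add: best_proximity_fixes_twice)
  moreover have "\<phi> D < \<phi> ?t" if "D < ?t"
    using strict_mono_onD[OF mono, of D ?t] that by simp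
  ultimately have "?t \<le> D"
    by (smt (verit))
  then show ?thesis
    using same_nearest_imp_eq[OF \<open>p \<in> P\<close> \<open>p' \<in> P\<close> \<open>F p' \<in> Q\<close>] assms by simp
qed

definition orbit :: "'b \<Rightarrow> nat \<Rightarrow> 'b" where
  "orbit p n = ((F \<circ> F) ^^ n) p"

lemma orbit_Suc: "orbit p (Suc n) = F (F (orbit p n))"
  by (simp add: orbit_def)

lemma orbit_in_P: "p \<in> P \<Longrightarrow> orbit p n \<in> P"
proof (induction n)
  case 0
  then show ?case
    by (simp add: orbit_def)
next
  case (Suc n)
  then show ?case
    by (simp add: orbit_Suc F_P F_Q)
qed

lemma orbit_proximity:
  assumes "p \<in> P" "0 < e"
  shows "\<exists>N. \<forall>n\<ge>N. d (orbit p n) (F (orbit p n)) < D + e"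
proof (rule decrease_by_excess_eventually_small[OF mono _ _ \<open>0 < e\<close>])
  fix n
  note in_P = orbit_in_P[OF \<open>p \<in> P\<close>, of n]
  show "D \<le> d (orbit p n) (F (orbit p n))"
    using in_P by (intro D_le F_P)
  show "d (orbit p (Suc n)) (F (orbit p (Suc n)))
      \<le> d (orbit p n) (F (orbit p n)) - \<phi> (d (orbit p n) (F (orbit p n))) + \<phi> D"
    unfolding orbit_Suc using in_P by (intro twice_contraction F_P)
qed

text \<open>The point \<open>F (orbit p n)\<close> is almost at distance \<open>D\<close> from both of its neighbours
  \<open>orbit p n\<close> and \<open>orbit p (Suc n)\<close> in the orbit of \<open>F\<close>.\<close>

lemma orbit_steps_small:
  assumes "p \<in> P" "0 < e"
  shows "\<exists>N. \<forall>n\<ge>N. d (orbit p (Suc n)) (orbit p n) < e"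
proof -
  obtain \<eta> where "\<eta> > 0"
    and \<eta>: "\<forall>p\<in>P. \<forall>p'\<in>P. \<forall>q\<in>Q. d p q < D + \<eta> \<longrightarrow> d p' q < D + \<eta> \<longrightarrow> d p p' < e"
    using proximity[OF \<open>0 < e\<close>] by blast
  obtain N where N: "\<forall>n\<ge>N. d (orbit p n) (F (orbit p n)) < D + \<eta>"
    using orbit_proximity[OF \<open>p \<in> P\<close> \<open>\<eta> > 0\<close>] by blast
  have "d (orbit p (Suc n)) (orbit p n) < e" if "n \<ge> N" for n
  proof -
    have "F (orbit p n) \<in> Q"
      by (intro F_P orbit_in_P \<open>p \<in> P\<close>)
    moreover have "d (orbit p (Suc n)) (F (orbit p n)) \<le> d (orbit p n) (F (orbit p n))"
      using nonexpansive[of "orbit p n" "F (orbit p n)"] orbit_in_P[OF \<open>p \<in> P\<close>, of n]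
      by (simp add: F_P orbit_Suc commute)
    ultimately show ?thesis
      using \<eta> N that orbit_in_P[OF \<open>p \<in> P\<close>] by (meson le_less_trans)
  qed
  then show ?thesis by blast
qed

text \<open>Induction on \<open>m\<close> with \<open>n\<close> fixed.  Passing from \<open>m\<close> to \<open>m + 1\<close> applies \<open>F \<circ> F\<close> to
  both points and then moves the first one back by one small step of the orbit.  A distance below
  \<open>D + e / 2\<close> does not grow under \<open>F \<circ> F\<close> and leaves room for that step; a larger one shrinks by
  at least \<open>\<phi> (D + e / 2) - \<phi> D\<close>, which pays for it.\<close>

lemma orbit_uniform_proximity:
  assumes "p \<in> P" "0 < e"
  shows "\<exists>N. \<forall>n\<ge>N. \<forall>m\<ge>n. d (orbit p n) (F (orbit p m)) < D + e"
proof -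
  define c where "c = \<phi> (D + e / 2) - \<phi> D"
  have "c > 0"
    using strict_mono_onD[OF mono, of D "D + e / 2"] \<open>0 < e\<close> by (simp add: c_def)
  obtain N1 where N1: "\<forall>n\<ge>N1. d (orbit p n) (F (orbit p n)) < D + e"
    using orbit_proximity[OF assms] by blast
  obtain N2 where N2: "\<forall>n\<ge>N2. d (orbit p (Suc n)) (orbit p n) < min c (e / 2)"
    using orbit_steps_small[OF \<open>p \<in> P\<close>, of "min c (e / 2)"] \<open>c > 0\<close> \<open>0 < e\<close> by auto
  have "d (orbit p n) (F (orbit p m)) < D + e" if "n \<ge> max N1 N2" "m \<ge> n" for n m
    using \<open>m \<ge> n\<close>
  proof (induction m rule: dec_induct)
    case base
    then show ?case
      using N1 that by simp
  next
    case (step m)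
    define t where "t = d (orbit p n) (F (orbit p m))"
    have in_P: "orbit p k \<in> P" for k
      by (rule orbit_in_P[OF \<open>p \<in> P\<close>])
    have "D \<le> t"
      unfolding t_def by (intro D_le F_P in_P)
    have "d (orbit p n) (F (orbit p (Suc m)))
        \<le> d (orbit p n) (orbit p (Suc n)) + d (orbit p (Suc n)) (F (orbit p (Suc m)))"
      using in_P F_P P_sub Q_sub by (intro triangle) blast+
    moreover have "d (orbit p n) (orbit p (Suc n)) < min c (e / 2)"
      using N2 that by (simp add: commute)
    moreover have "d (orbit p (Suc n)) (F (orbit p (Suc m))) \<le> t - \<phi> t + \<phi> D"
      unfolding t_def orbit_Suc by (intro twice_contraction F_P in_P)
    moreover have "\<phi> D \<le> \<phi> t"
      using strict_mono_on_leD[OF mono, of D t] \<open>D \<le> t\<close> by simp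
    moreover have "\<phi> D + c \<le> \<phi> t" if "D + e / 2 \<le> t"
      using strict_mono_on_leD[OF mono, of "D + e / 2" t] that \<open>0 < e\<close> by (simp add: c_def)
    moreover have "t < D + e"
      using step.IH by (simp add: t_def)
    ultimately show ?case
      by (smt (verit) field_sum_of_halves)
  qed
  then show ?thesis by blast
qed

lemma Cauchy_orbit:
  assumes "p \<in> P"
  shows "MCauchy (orbit p)"
  unfolding MCauchy_def
proof (intro conjI allI impI)
  show "range (orbit p) \<subseteq> M"
    using orbit_in_P[OF assms] P_sub by blast
next
  fix e :: real
  assume "e > 0"
  then obtain \<eta> where "\<eta> > 0"
    and \<eta>: "\<forall>p\<in>P. \<forall>p'\<in>P. \<forall>q\<in>Q. d p q < D + \<eta> \<longrightarrow> d p' q < D + \<eta> \<longrightarrow> d p p' < e"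
    using proximity by blast
  obtain N where N: "\<forall>n\<ge>N. \<forall>m\<ge>n. d (orbit p n) (F (orbit p m)) < D + \<eta>"
    using orbit_uniform_proximity[OF assms \<open>\<eta> > 0\<close>] by blast
  have "d (orbit p n) (orbit p m) < e" if "N \<le> n" "N \<le> m" for n m
  proof -
    \<comment> \<open>the later of the two points supplies the common point of \<open>Q\<close>\<close>
    have "F (orbit p (max n m)) \<in> Q"
      by (intro F_P orbit_in_P assms)
    then show ?thesis
      using \<eta> N that orbit_in_P[OF assms] by simp
  qed
  then show "\<exists>N. \<forall>n n'. N \<le> n \<longrightarrow> N \<le> n' \<longrightarrow> d (orbit p n) (orbit p n') < e"
    by blast
qed

text \<open>For the limit \<open>l\<close>, the chain from \<open>l\<close> over \<open>orbit p (Suc n)\<close> to \<open>F l\<close> reduces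
  \<open>d l (F l)\<close> by nonexpansiveness to \<open>d l (F (orbit p n))\<close>, and the latter to
  \<open>d (orbit p n) (F (orbit p n))\<close>, at the cost of small terms.\<close>

lemma orbit_limit_best_proximity:
  assumes "p \<in> P" "l \<in> P" and lim: "(\<lambda>n. d (orbit p n) l) \<longlonglongrightarrow> 0"
  shows "d l (F l) = D"
proof (rule antisym)
  show "D \<le> d l (F l)"
    using assms by (intro D_le F_P)
  show "d l (F l) \<le> D"
  proof (rule field_le_epsilon)
    fix e :: real
    assume "e > 0"
    then have "e / 3 > 0" by simp
    obtain N1 where N1: "\<forall>n\<ge>N1. d (orbit p n) (F (orbit p n)) < D + e / 3"
      using orbit_proximity[OF \<open>p \<in> P\<close> \<open>e / 3 > 0\<close>] by blast
    obtain N2 where N2: "\<forall>n\<ge>N2. d (orbit p n) l < e / 3"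
      using order_tendstoD(2)[OF lim \<open>e / 3 > 0\<close>] by (auto simp: eventually_sequentially)
    define n where "n = max N1 N2"
    define a where "a = orbit p n"
    define a' where "a' = orbit p (Suc n)"
    have "a \<in> P" "a' \<in> P"
      unfolding a_def a'_def by (auto intro: orbit_in_P \<open>p \<in> P\<close>)
    then have "a \<in> M" "a' \<in> M" "l \<in> M" "F a \<in> M" "F l \<in> M"
      using assms P_sub Q_sub F_P by blast+
    then have "d l (F l) \<le> d l a' + d a' (F l)" "d l (F a) \<le> d l a + d a (F a)"
      by (auto intro: triangle)
    moreover have "d a' (F l) \<le> d l (F a)"
      using nonexpansive[of l "F a"] F_P \<open>a \<in> P\<close> \<open>l \<in> P\<close>
      by (simp add: a_def a'_def orbit_Suc commute)
    moreover have "d l a < e / 3" "d l a' < e / 3"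
      using N2 by (auto simp: a_def a'_def n_def commute)
    moreover have "d a (F a) < D + e / 3"
      using N1 by (simp add: a_def n_def)
    ultimately show "d l (F l) \<le> D + e" by linarith
  qed
qed

theorem best_proximity_ex1:
  assumes "P \<noteq> {}"
    and complete: "\<And>\<sigma>. MCauchy \<sigma> \<Longrightarrow> range \<sigma> \<subseteq> P \<Longrightarrow> \<exists>l\<in>P. (\<lambda>n. d (\<sigma> n) l) \<longlonglongrightarrow> 0"
  shows "\<exists>!p. p \<in> P \<and> d p (F p) = D"
proof -
  obtain p where "p \<in> P"
    using \<open>P \<noteq> {}\<close> by blast
  then have "range (orbit p) \<subseteq> P"
    using orbit_in_P by blast
  then obtain l where "l \<in> P" "(\<lambda>n. d (orbit p n) l) \<longlonglongrightarrow> 0"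
    using complete Cauchy_orbit[OF \<open>p \<in> P\<close>] by blast
  then show ?thesis
    using orbit_limit_best_proximity[OF \<open>p \<in> P\<close>] best_proximity_unique by blast
qed

end

section \<open>Proximity in uniformly convex spaces\<close>

text \<open>If \<open>a\<close> and \<open>a'\<close> are at least \<open>e\<close> apart and both within \<open>D + \<eta>\<close> of \<open>b\<close>, then their
  midpoint, which is again in \<open>A\<close>, is within \<open>(1 - \<kappa>) (D + \<eta>)\<close> of \<open>b\<close> for a \<open>\<kappa> > 0\<close> that
  does not depend on \<open>\<eta> \<le> 1\<close>.  For \<open>D > 0\<close> and small \<open>\<eta>\<close> this is less than \<open>D\<close>.  For
  \<open>D = 0\<close> the triangle inequality suffices.\<close>

lemma uniformly_convex_proximity:
  fixes A B :: "'a::real_normed_vector set"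
  assumes uc: "uniformly_convex_space TYPE('a)" and "convex A" and "0 < e"
  shows "\<exists>\<eta>>0. \<forall>a\<in>A. \<forall>a'\<in>A. \<forall>b\<in>B.
    norm (a - b) < setdist A B + \<eta> \<longrightarrow> norm (a' - b) < setdist A B + \<eta> \<longrightarrow> norm (a - a') < e"
proof (cases "setdist A B = 0")
  case True
  have "norm (a - a') < e" if "norm (a - b) < e / 2" "norm (a' - b) < e / 2" for a a' b :: 'a
    using that norm_triangle_half_l by blast
  then show ?thesis
    using True \<open>0 < e\<close> by (intro exI[of _ "e / 2"]) auto
next
  case False
  define D where "D = setdist A B"
  have "D > 0"
    using False setdist_pos_le[of A B] unfolding D_def by linarith
  obtain \<delta> where mono: "strict_mono_on {0<..2} \<delta>" and ran: "\<delta> ` {0<..2} \<subseteq> {0..1}"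
    and conv: "\<And>(x::'a) y z R r. 0 < R \<Longrightarrow> r \<in> {0<..2 * R} \<Longrightarrow> norm (x - z) \<le> R \<Longrightarrow>
      norm (y - z) \<le> R \<Longrightarrow> r \<le> norm (x - y) \<Longrightarrow>
      norm ((1 / 2) *\<^sub>R (x + y) - z) \<le> (1 - \<delta> (r / R)) * R"
    using uc unfolding uniformly_convex_space_def by blast
  \<comment> \<open>\<open>t\<close> bounds the ratios \<open>e / (D + \<eta>)\<close>, \<open>\<eta> \<le> 1\<close>, from below; it is cut off at 2 to stay
    in the domain of the modulus\<close>
  define t where "t = min 2 (e / (D + 1))"
  have "0 < t" "t \<le> 2"
    using \<open>0 < e\<close> \<open>D > 0\<close> by (auto simp: t_def)
  define \<kappa> where "\<kappa> = \<delta> t"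
  have "0 \<le> \<delta> (t / 2)"
    using ran \<open>0 < t\<close> \<open>t \<le> 2\<close> by (force simp: image_subset_iff)
  also have "\<dots> < \<kappa>"
    unfolding \<kappa>_def using \<open>0 < t\<close> \<open>t \<le> 2\<close> by (intro strict_mono_onD[OF mono]) auto
  finally have "\<kappa> > 0" .
  define \<eta> where "\<eta> = min 1 (D * \<kappa> / 2)"
  have "\<eta> > 0" "\<eta> \<le> 1" "\<eta> \<le> D * \<kappa> / 2"
    using \<open>D > 0\<close> \<open>\<kappa> > 0\<close> by (auto simp: \<eta>_def)
  have "norm (a - a') < e"
    if "a \<in> A" "a' \<in> A" "b \<in> B" and near: "norm (a - b) < D + \<eta>" "norm (a' - b) < D + \<eta>"
    for a a' b
  proof (rule ccontr)
    assume "\<not> norm (a - a') < e"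
    then have "e \<le> norm (a - a')" by simp
    define R where "R = D + \<eta>"
    have "R > 0"
      using \<open>D > 0\<close> \<open>\<eta> > 0\<close> by (simp add: R_def)
    have "norm (a - a') \<le> norm (a - b) + norm (a' - b)"
      by (metis norm_triangle_ineq4 diff_diff_eq2 diff_add_cancel)
    then have "e \<le> 2 * R"
      using near \<open>e \<le> norm (a - a')\<close> by (simp add: R_def)
    let ?c = "(1 / 2) *\<^sub>R (a + a')"
    have "?c \<in> A"
      using convexD[OF \<open>convex A\<close> \<open>a \<in> A\<close> \<open>a' \<in> A\<close>, of "1/2" "1/2"]
      by (simp add: scaleR_add_right)
    then have "D \<le> norm (?c - b)"
      using setdist_le_dist[OF _ \<open>b \<in> B\<close>] by (simp add: D_def dist_norm)
    also have "\<dots> \<le> (1 - \<delta> (e / R)) * R"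
      using near \<open>e \<le> norm (a - a')\<close> \<open>R > 0\<close> \<open>0 < e\<close> \<open>e \<le> 2 * R\<close>
      by (intro conv) (auto simp: R_def)
    also have "\<dots> \<le> (1 - \<kappa>) * R"
    proof -
      have "e / (D + 1) \<le> e / R"
        using \<open>0 < e\<close> \<open>R > 0\<close> \<open>\<eta> \<le> 1\<close> by (intro divide_left_mono) (auto simp: R_def)
      then have "t \<le> e / R"
        by (simp add: t_def)
      moreover have "e / R \<le> 2"
        using \<open>e \<le> 2 * R\<close> \<open>R > 0\<close> by (simp add: divide_le_eq)
      ultimately have "\<kappa> \<le> \<delta> (e / R)"
        unfolding \<kappa>_def using \<open>0 < t\<close> by (intro strict_mono_on_leD[OF mono]) auto
      then show ?thesis
        using \<open>R > 0\<close> by (simp add: mult_right_mono)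
    qed
    also have "\<dots> < D"
    proof -
      have "0 < D * \<kappa>" "0 < \<kappa> * \<eta>"
        using \<open>D > 0\<close> \<open>\<kappa> > 0\<close> \<open>\<eta> > 0\<close> by simp_all
      then show ?thesis
        using \<open>\<eta> \<le> D * \<kappa> / 2\<close> by (simp add: R_def algebra_simps)
    qed
    finally show False by simp
  qed
  then show ?thesis
    using \<open>\<eta> > 0\<close> unfolding D_def by blast
qed

section \<open>The maximum metric and the doubled map\<close>

lemma max_norm_less_iff: "max_norm p < e \<longleftrightarrow> norm (fst p) < e \<and> norm (snd p) < e"
  by (simp add: max_norm_def)

interpretation max_metric: Metric_space UNIV "\<lambda>p q :: 'a::real_normed_vector \<times> 'a. max_norm (p - q)"
proof
  fix p q r :: "'a \<times> 'a"
  show "0 \<le> max_norm (p - q)"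
    by (simp add: max_norm_def le_max_iff_disj)
  show "max_norm (p - q) = max_norm (q - p)"
    by (simp add: max_norm_def norm_minus_commute)
  show "max_norm (p - q) = 0 \<longleftrightarrow> p = q"
  proof
    assume "max_norm (p - q) = 0"
    then have "norm (fst p - fst q) \<le> 0" "norm (snd p - snd q) \<le> 0"
      unfolding max_norm_def fst_diff snd_diff by linarith+
    then show "p = q"
      by (simp add: prod_eq_iff)
  qed (simp add: max_norm_def)
  have "norm (fst p - fst r) \<le> norm (fst p - fst q) + norm (fst q - fst r)"
    "norm (snd p - snd r) \<le> norm (snd p - snd q) + norm (snd q - snd r)"
    using norm_triangle_ineq[of "fst p - fst q" "fst q - fst r"]
      norm_triangle_ineq[of "snd p - snd q" "snd q - snd r"] by simp_all
  then show "max_norm (p - r) \<le> max_norm (p - q) + max_norm (q - r)"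
    unfolding max_norm_def fst_diff snd_diff by linarith
qed

lemma max_metric_Times_complete:
  fixes A B :: "'a::banach set"
  assumes "closed A" "closed B"
    and Cauchy: "max_metric.MCauchy \<sigma>" and range: "range \<sigma> \<subseteq> A \<times> B"
  shows "\<exists>l\<in>A \<times> B. (\<lambda>n. max_norm (\<sigma> n - l)) \<longlonglongrightarrow> 0"
proof -
  have Ex: "\<exists>N. \<forall>m n. N \<le> m \<longrightarrow> N \<le> n \<longrightarrow> max_norm (\<sigma> m - \<sigma> n) < e" if "e > 0" for e
    using Cauchy that by (simp add: max_metric.MCauchy_def)
  have "Cauchy (\<lambda>n. fst (\<sigma> n))" "Cauchy (\<lambda>n. snd (\<sigma> n))"
    unfolding Cauchy_iff using Ex by (simp_all add: max_norm_less_iff) metis+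
  then obtain a b where a: "(\<lambda>n. fst (\<sigma> n)) \<longlonglongrightarrow> a" and b: "(\<lambda>n. snd (\<sigma> n)) \<longlonglongrightarrow> b"
    unfolding Cauchy_convergent_iff convergent_def by blast
  have "\<sigma> n \<in> A \<times> B" for n
    using range by blast
  then have "a \<in> A" "b \<in> B"
    using closed_sequentially[OF \<open>closed A\<close> _ a] closed_sequentially[OF \<open>closed B\<close> _ b]
    by (auto simp: mem_Times_iff)
  moreover have "(\<lambda>n. max (norm (fst (\<sigma> n) - a)) (norm (snd (\<sigma> n) - b))) \<longlonglongrightarrow> max 0 0"
    using a b by (intro tendsto_max) (simp_all add: tendsto_norm_zero LIM_zero)
  ultimately show ?thesis
    by (intro bexI[of _ "(a, b)"]) (simp_all add: max_norm_def)
qed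

lemma setdist_le_max_norm:
  assumes "p \<in> A \<times> B" "q \<in> B \<times> A"
  shows "setdist A B \<le> max_norm (p - q)"
proof -
  have "setdist A B \<le> norm (fst p - fst q)"
    using assms setdist_le_dist[of "fst p" A "fst q" B] by (auto simp: dist_norm)
  then show ?thesis
    by (simp add: max_norm_def)
qed

definition doubled :: "('a \<times> 'a \<Rightarrow> 'a) \<Rightarrow> 'a \<times> 'a \<Rightarrow> 'a \<times> 'a" where
  "doubled T p = (T p, T (prod.swap p))"

text \<open>The second component of the contraction inequality for \<open>p\<close> and \<open>q\<close> is the
  hypothesis for the swapped pairs, whose order is reversed because swapping moves \<open>q\<close> to
  \<open>A \<times> B\<close> and \<open>p\<close> to \<open>B \<times> A\<close>.\<close>

lemma doubled_proximal_cyclic_contraction: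
  fixes A B :: "'a::real_normed_vector set"
  assumes uc: "uniformly_convex_space TYPE('a)" and "convex A" "convex B"
    and T: "p_cyclic_contraction A B \<phi> T"
  shows "proximal_cyclic_contraction UNIV (\<lambda>p q. max_norm (p - q))
    (A \<times> B) (B \<times> A) (doubled T) \<phi> (setdist A B)"
proof
  have mono: "strict_mono_on {0..} \<phi>" and T_AB: "T ` (A \<times> B) \<subseteq> B" and T_BA: "T ` (B \<times> A) \<subseteq> A"
    and contr: "\<And>p q. p \<in> A \<times> B \<Longrightarrow> q \<in> B \<times> A \<Longrightarrow>
      norm (T p - T q) \<le> max_norm (p - q) - \<phi> (max_norm (p - q)) + \<phi> (setdist A B)"
    using T unfolding p_cyclic_contraction_def by blast+
  show "A \<times> B \<subseteq> UNIV" "B \<times> A \<subseteq> UNIV"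
    by simp_all
  show "doubled T p \<in> B \<times> A" if "p \<in> A \<times> B" for p
    using that T_AB T_BA by (auto simp: doubled_def image_subset_iff)
  show "doubled T q \<in> A \<times> B" if "q \<in> B \<times> A" for q
    using that T_AB T_BA by (auto simp: doubled_def image_subset_iff)
  show "setdist A B \<le> max_norm (p - q)" if "p \<in> A \<times> B" "q \<in> B \<times> A" for p q
    using that by (rule setdist_le_max_norm)
  show "strict_mono_on {setdist A B..} \<phi>"
    using mono setdist_pos_le[of A B] by (auto intro: monotone_on_subset)
  show "max_norm (doubled T p - doubled T q)
      \<le> max_norm (p - q) - \<phi> (max_norm (p - q)) + \<phi> (setdist A B)"
    if "p \<in> A \<times> B" "q \<in> B \<times> A" for p q
  proof -
    have "max_norm (prod.swap q - prod.swap p) = max_norm (p - q)"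
      by (simp add: max_norm_def norm_minus_commute max.commute)
    moreover have "prod.swap q \<in> A \<times> B" "prod.swap p \<in> B \<times> A"
      using that by auto
    ultimately have "norm (T (prod.swap q) - T (prod.swap p))
        \<le> max_norm (p - q) - \<phi> (max_norm (p - q)) + \<phi> (setdist A B)"
      using contr by metis
    then show ?thesis
      using contr[OF that] by (simp add: doubled_def max_norm_def norm_minus_commute)
  qed
  show "\<exists>\<eta>>0. \<forall>p\<in>A \<times> B. \<forall>p'\<in>A \<times> B. \<forall>q\<in>B \<times> A.
      max_norm (p - q) < setdist A B + \<eta> \<longrightarrow> max_norm (p' - q) < setdist A B + \<eta> \<longrightarrow>
      max_norm (p - p') < e" if "e > 0" for e
  proof -
    obtain \<eta>1 where "\<eta>1 > 0" and \<eta>1: "\<And>a a' b. a \<in> A \<Longrightarrow> a' \<in> A \<Longrightarrow> b \<in> B \<Longrightarrow>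
        norm (a - b) < setdist A B + \<eta>1 \<Longrightarrow> norm (a' - b) < setdist A B + \<eta>1 \<Longrightarrow> norm (a - a') < e"
      using uniformly_convex_proximity[OF uc \<open>convex A\<close> \<open>e > 0\<close>, of B] by blast
    obtain \<eta>2 where "\<eta>2 > 0" and \<eta>2: "\<And>b b' a. b \<in> B \<Longrightarrow> b' \<in> B \<Longrightarrow> a \<in> A \<Longrightarrow>
        norm (b - a) < setdist A B + \<eta>2 \<Longrightarrow> norm (b' - a) < setdist A B + \<eta>2 \<Longrightarrow> norm (b - b') < e"
      using uniformly_convex_proximity[OF uc \<open>convex B\<close> \<open>e > 0\<close>, of A]
      by (subst (asm) (1 2) setdist_sym) blast
    have "max_norm (p - p') < e"
      if "p \<in> A \<times> B" "p' \<in> A \<times> B" "q \<in> B \<times> A"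
        and near: "max_norm (p - q) < setdist A B + min \<eta>1 \<eta>2"
          "max_norm (p' - q) < setdist A B + min \<eta>1 \<eta>2" for p p' q
      unfolding max_norm_less_iff fst_diff snd_diff
    proof
      show "norm (fst p - fst p') < e"
        using that by (intro \<eta>1[where b = "fst q"]) (auto simp: max_norm_less_iff)
      show "norm (snd p - snd p') < e"
        using that by (intro \<eta>2[where a = "snd q"]) (auto simp: max_norm_less_iff)
    qed
    then show ?thesis
      using \<open>\<eta>1 > 0\<close> \<open>\<eta>2 > 0\<close> by (intro exI[of _ "min \<eta>1 \<eta>2"]) auto
  qed
qed

text \<open>A maximum of two numbers that are both at least \<open>dist(A, B)\<close> equals \<open>dist(A, B)\<close> only if
  both do.\<close>

lemma coupled_best_proximity_point_iff_doubled:
  fixes A B :: "'a::real_normed_vector set"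
  assumes "p_cyclic_contraction A B \<phi> T"
  shows "coupled_best_proximity_point A B T p \<longleftrightarrow>
    p \<in> A \<times> B \<and> max_norm (p - doubled T p) = setdist A B"
proof (cases "p \<in> A \<times> B")
  case True
  then obtain a b where p: "p = (a, b)" and "a \<in> A" "b \<in> B" by auto
  then have "T (a, b) \<in> B" "T (b, a) \<in> A"
    using assms unfolding p_cyclic_contraction_def by blast+
  then have "setdist A B \<le> norm (a - T (a, b))" "setdist A B \<le> norm (b - T (b, a))"
    using setdist_le_dist[OF \<open>a \<in> A\<close>, of "T (a, b)" B] setdist_le_dist[of "T (b, a)" A b B]
      \<open>b \<in> B\<close> by (simp_all add: dist_norm norm_minus_commute)
  then show ?thesis
    using True by (auto simp: p coupled_best_proximity_point_def doubled_def max_norm_def)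
next
  case False
  then show ?thesis
    by (auto simp: coupled_best_proximity_point_def)
qed

section \<open>Coupled best proximity points\<close>

theorem theorem2p10:
  fixes A B :: "'a::banach set"
    and \<phi> :: "real \<Rightarrow> real"
    and T :: "'a \<times> 'a \<Rightarrow> 'a"
    and x y :: "nat \<Rightarrow> 'a"
  assumes "uniformly_convex_space TYPE('a)"
    and "A \<noteq> {}" and "closed A" and "convex A"
    and "B \<noteq> {}" and "closed B" and "convex B"
    and "p_cyclic_contraction A B \<phi> T"
    and "(x 0, y 0) \<in> A \<times> B"
    and "\<And>n. n \<ge> 1 \<Longrightarrow> x n = T (x (n - 1), y (n - 1))"
    and "\<And>n. n \<ge> 1 \<Longrightarrow> y n = T (y (n - 1), x (n - 1))"
  shows "\<exists>!p. coupled_best_proximity_point A B T p"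
proof -
  interpret proximal_cyclic_contraction UNIV "\<lambda>p q. max_norm (p - q)"
    "A \<times> B" "B \<times> A" "doubled T" \<phi> "setdist A B"
    using assms by (intro doubled_proximal_cyclic_contraction)
  have "\<exists>!p. p \<in> A \<times> B \<and> max_norm (p - doubled T p) = setdist A B"
    using assms max_metric_Times_complete[OF \<open>closed A\<close> \<open>closed B\<close>]
    by (intro best_proximity_ex1) auto
  then show ?thesis
    using coupled_best_proximity_point_iff_doubled[OF \<open>p_cyclic_contraction A B \<phi> T\<close>] by simp
qed

end
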